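(* Let $G$ be a graph and let $G'$ be a connected induced subgraph of $G$. Then $\mathsf{mtd}(G') \le \mathsf{mtd}(G)$ if $\mathsf{mtd}(G)$ is even, and $\mathsf{mtd}(G') \le \mathsf{mtd}(G)+1$ if $\mathsf{mtd}(G)$ is odd.
   Context: An elimination tree of a connected graph $G$ is a rooted tree $(T,r)$ with $r\in V(G)$ whose root-subtrees are, recursively, elimination trees of the connected components of $G - r$; its depth is the maximum number of vertices on a root-to-leaf path. A matched elimination tree is an elimination tree such that for every root-to-leaf path $(v_1,\dots,v_k)$: if $k$ is even, $v_1v_2, v_3v_4,\dots,v_{k-1}v_k$ are edges of $G$; if $k$ is odd, the sequence splits into consecutive blocks, all of size 2 except exactly one of size 3, where each size-2 block $(v_j,v_{j+1})$ has $v_jv_{j+1}\in E(G)$ and the size-3 block $(v_j,v_{j+1},v_{j+2})$ has $v_jv_{j+1},v_{j+1}v_{j+2}\in E(G)$. The matched treedepth $\mathsf{mtd}(G)$ is the minimum depth of a matched elimination tree; for a disconnected graph it is the maximum over its connected components.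
   Formalization: Read literally, a one-vertex graph has no matched elimination tree (a path with k = 1 has no block of size 3), so its mtd is undefined; here mtd of a one-vertex graph, also as a component of a disconnected graph, is set to 1. *)

theory Defs
  imports "Graph_Theory.Digraph_Component" "HOL-Library.FSet"
begin

text \<open>
  A finite simple undirected graph is a digraph satisfying the locale predicate
  \<^const>\<open>graph\<close>, in which every edge is represented by two opposite arcs. The library predicate
  \<^const>\<open>connected\<close> implies that the graph has at least one vertex.
\<close>

definition components :: "('a, 'b) pre_digraph \<Rightarrow> ('a, 'b) pre_digraph set" where
  "components G = {C. pre_digraph.max_subgraph G connected C}"

datatype 'a rtree = RNode 'a "'a rtree fset"

text \<open>
  The function \<open>f\<close> picks one elimination tree for each component of \<open>G - r\<close>. These trees have
  pairwise different roots, so collecting them in a set loses nothing.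
\<close>

inductive elimination_tree :: "('a, 'b) pre_digraph \<Rightarrow> 'a rtree \<Rightarrow> bool" where
  "\<lbrakk>connected G; r \<in> verts G;
    \<forall>C \<in> components (pre_digraph.del_vert G r). elimination_tree C (f C);
    fset ts = f ` components (pre_digraph.del_vert G r)\<rbrakk>
   \<Longrightarrow> elimination_tree G (RNode r ts)"

inductive root_leaf_path :: "'a rtree \<Rightarrow> 'a list \<Rightarrow> bool" where
  "root_leaf_path (RNode r {||}) [r]"
| "\<lbrakk>t |\<in>| ts; root_leaf_path t p\<rbrakk> \<Longrightarrow> root_leaf_path (RNode r ts) (r # p)"

definition depth :: "'a rtree \<Rightarrow> nat" where
  "depth T = Max (length ` {p. root_leaf_path T p})"

text \<open>
  List positions start at 0, so the pairs \<open>v\<^sub>1v\<^sub>2, v\<^sub>3v\<^sub>4, \<dots>\<close> start at the even positions. In the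
  odd case \<open>bs\<close> is the list of blocks and \<open>j\<close> the position of the unique block of size 3.
\<close>

definition matched_path :: "('a, 'b) pre_digraph \<Rightarrow> 'a list \<Rightarrow> bool" where
  "matched_path G p \<longleftrightarrow>
    (if even (length p)
     then \<forall>i. even i \<and> i + 1 < length p \<longrightarrow> p ! i \<rightarrow>\<^bsub>G\<^esub> p ! (i + 1)
     else \<exists>bs j. p = concat bs \<and> j < length bs \<and>
            (\<forall>i < length bs. length (bs ! i) = (if i = j then 3 else 2)) \<and>
            (\<forall>b \<in> set bs. successively (\<lambda>u v. u \<rightarrow>\<^bsub>G\<^esub> v) b))"

definition matched_elimination_tree :: "('a, 'b) pre_digraph \<Rightarrow> 'a rtree \<Rightarrow> bool" where
  "matched_elimination_tree G T \<longleftrightarrow>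
    elimination_tree G T \<and> (\<forall>p. root_leaf_path T p \<longrightarrow> matched_path G p)"

text \<open>
  The only elimination tree of a one-vertex graph consists of a single path with one vertex, which
  has no decomposition into blocks of size 2 and one block of size 3. By convention the matched
  treedepth of such a graph is 1, the depth of this tree. Every other connected graph has a matched
  elimination tree, see \<open>matched_elimination_tree_exists\<close> below.
\<close>

definition mtd_connected :: "('a, 'b) pre_digraph \<Rightarrow> nat" where
  "mtd_connected G =
    (if card (verts G) = 1 then 1
     else LEAST d. \<exists>T. matched_elimination_tree G T \<and> depth T = d)"

definition mtd :: "('a, 'b) pre_digraph \<Rightarrow> nat" where
  "mtd G = Max (mtd_connected ` components G)"


lemma arc_mono_connected: "arc_mono connected"
  by (auto simp: arc_mono_def)
    (metis spanning_def subgraphE wf_digraph.connected_spanning_imp_connected)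

lemma strongly_connected_imp_connected:
  assumes "wf_digraph H" "strongly_connected H"
  shows "connected H"
proof -
  interpret wf_digraph H by fact
  show ?thesis
    using assms(2) unfolding connected_def strongly_connected_def
    by (auto intro: reachable_mk_symmetricI)
qed

lemma graph_induced_subgraph:
  assumes "graph G" "induced_subgraph H G"
  shows "graph H"
proof -
  interpret graph G by fact
  interpret H: digraph H using assms(2) by (rule digraphI_induced)
  interpret H: sym_digraph H using assms(2) by (rule induced_graph_imp_graph)
  show ?thesis by unfold_locales
qed

lemma induced_connected_iff:
  assumes "graph G" "induced_subgraph H G"
  shows "connected H \<longleftrightarrow> strongly_connected H"
proof -
  interpret H: graph H using assms by (rule graph_induced_subgraph)
  show ?thesis
    using H.symmetric_connected_imp_strongly_connected[OF H.sym_arcs]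
      strongly_connected_imp_connected[OF H.wf_digraph_axioms] by blast
qed

lemma components_eq_sccs:
  assumes "graph G"
  shows "components G = pre_digraph.sccs G"
proof -
  interpret graph G by fact
  have "max_subgraph connected H \<longleftrightarrow> H \<in> sccs" for H
  proof
    assume m: "max_subgraph connected H"
    have ind: "induced_subgraph H G"
      using m arc_mono_connected by (rule induced_subgraphI_arc_mono)
    have "\<not> strongly_connected y" if "H \<noteq> y" "subgraph H y" "subgraph y G" for y
      using m that strongly_connected_imp_connected[of y]
      by (auto simp: max_subgraph_def)
    moreover have "strongly_connected H"
      using m ind induced_connected_iff[OF assms ind] by (simp add: max_subgraph_def)
    ultimately have "max_subgraph strongly_connected H"
      using ind by (auto intro: max_subgraphI)
    then show "H \<in> sccs" by (simp add: sccs_altdef2)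
  next
    assume s: "H \<in> sccs"
    then have ind: "induced_subgraph H G" and sc: "strongly_connected H" by auto
    have "\<not> connected y" if y: "H \<noteq> y" "subgraph H y" "subgraph y G" for y
    proof
      assume "connected y"
      let ?Y = "G \<restriction> verts y"
      have Y: "induced_subgraph ?Y G" "subgraph y ?Y"
        using y(3) by (auto intro: subgraph_induce_subgraphI2)
      moreover have "verts y = verts ?Y" by simp
      ultimately have "connected ?Y"
        using \<open>connected y\<close> arc_mono_connected unfolding arc_mono_def by blast
      then have "strongly_connected ?Y"
        using induced_connected_iff[OF assms Y(1)] by simp
      moreover have "verts H \<subset> verts ?Y"
        using ind y by (auto simp: induced_subgraph_altdef2 max_subgraph_def)
      ultimately show False using s Y(1) unfolding sccs_def by blast
    qed
    then show "max_subgraph connected H"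
      using ind induced_connected_iff[OF assms ind] sc by (auto intro: max_subgraphI)
  qed
  then show ?thesis by (auto simp: components_def)
qed

lemma components_connected:
  assumes "graph G" "connected G"
  shows "components G = {G}"
proof -
  interpret graph G by fact
  have "strongly_connected G"
    using assms(2) sym_arcs by (intro symmetric_connected_imp_strongly_connected)
  then show ?thesis
    using components_eq_sccs[OF assms(1)] strongly_connected_eq_iff by simp
qed

lemma mtd_eq_mtd_connected:
  assumes "graph G" "connected G"
  shows "mtd G = mtd_connected G"
  by (simp add: mtd_def components_connected[OF assms])


lemma root_leaf_path_exists: "\<exists>p. root_leaf_path T p"
proof (induction T)
  case (RNode r ts)
  show ?case
  proof (cases "ts = {||}")
    case True
    then show ?thesis by (auto intro: root_leaf_path.intros)
  next
    case False
    then obtain t where "t |\<in>| ts" by auto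
    with RNode.IH show ?thesis by (blast intro: root_leaf_path.intros)
  qed
qed

lemma finite_root_leaf_paths: "finite {p. root_leaf_path T p}"
proof (induction T)
  case (RNode r ts)
  have "{p. root_leaf_path (RNode r ts) p}
      \<subseteq> insert [r] (\<Union>t \<in> fset ts. (#) r ` {p. root_leaf_path t p})"
  proof
    fix p assume "p \<in> {p. root_leaf_path (RNode r ts) p}"
    then have "root_leaf_path (RNode r ts) p" by simp
    then show "p \<in> insert [r] (\<Union>t \<in> fset ts. (#) r ` {p. root_leaf_path t p})"
      by cases auto
  qed
  moreover have "finite (insert [r] (\<Union>t \<in> fset ts. (#) r ` {p. root_leaf_path t p}))"
    using RNode.IH by auto
  ultimately show ?case by (rule finite_subset)
qed

lemma root_leaf_path_hd:
  assumes "root_leaf_path (RNode s ts) p"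
  obtains q where "p = s # q"
  using assms by (auto elim: root_leaf_path.cases)

lemma graph_del_vert:
  assumes "graph G"
  shows "graph (pre_digraph.del_vert G r)"
proof -
  interpret graph G by fact
  have "induced_subgraph (del_vert r) G"
    using subgraph_del_vert[of r] wellformed
    by (auto simp: induced_subgraph_def del_vert_simps)
  with assms show ?thesis by (rule graph_induced_subgraph)
qed

lemma dominates_del_vert:
  "u \<rightarrow>\<^bsub>pre_digraph.del_vert G r\<^esub> v \<longleftrightarrow> u \<rightarrow>\<^bsub>G\<^esub> v \<and> u \<noteq> r \<and> v \<noteq> r"
  by (auto simp: arcs_ends_conv pre_digraph.del_vert_simps)

lemma component_del_vert_adjacent:
  assumes "graph G" "connected G" "r \<in> verts G"
    and C: "C \<in> components (pre_digraph.del_vert G r)"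
  shows "\<exists>s \<in> verts C. r \<rightarrow>\<^bsub>G\<^esub> s"
proof (rule ccontr)
  assume no: "\<not> ?thesis"
  interpret graph G by fact
  interpret D: graph "del_vert r" using assms(1) by (rule graph_del_vert)
  have Cs: "C \<in> D.sccs"
    using C components_eq_sccs[OF D.graph_axioms] by simp
  then have "subgraph C (del_vert r)" by auto
  then have CG: "verts C \<subseteq> verts G - {r}" by (auto simp: subgraph_def del_vert_simps)
  have "verts C \<in> D.sccs_verts" using Cs by (simp add: D.sccs_verts_conv)
  then have out: "\<And>x y. x \<in> verts C \<Longrightarrow> y \<notin> verts C \<Longrightarrow>
      \<not> x \<rightarrow>\<^sup>*\<^bsub>del_vert r\<^esub> y \<or> \<not> y \<rightarrow>\<^sup>*\<^bsub>del_vert r\<^esub> x" and "verts C \<noteq> {}"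
    unfolding D.in_sccs_verts_conv_reachable by blast+
  have step: "y \<in> verts C" if "x \<in> verts C" "x \<rightarrow>\<^bsub>G\<^esub> y" for x y
  proof (rule ccontr)
    assume y: "y \<notin> verts C"
    have yx: "y \<rightarrow>\<^bsub>G\<^esub> x" using that(2) sym_arcs by (auto simp: symmetric_def dest: symD)
    have "y \<noteq> r" using no that(1) yx by blast
    moreover have "x \<noteq> r" using CG that(1) by blast
    ultimately have "x \<rightarrow>\<^bsub>del_vert r\<^esub> y" "y \<rightarrow>\<^bsub>del_vert r\<^esub> x"
      using that(2) yx by (simp_all add: dominates_del_vert)
    then show False using out[OF that(1) y] by (auto intro: D.reachable_adjI)
  qed
  obtain u where u: "u \<in> verts C" using \<open>verts C \<noteq> {}\<close> by blast
  then have "u \<in> verts G" "r \<notin> verts C" using CG by auto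
  have "strongly_connected G"
    using assms(2) sym_arcs by (intro symmetric_connected_imp_strongly_connected)
  then have "u \<rightarrow>\<^sup>*\<^bsub>G\<^esub> r" using \<open>u \<in> verts G\<close> assms(3) by auto
  then have "r \<in> verts C"
    by (induction rule: reachable_induct) (use u step in blast)+
  with \<open>r \<notin> verts C\<close> show False ..
qed

lemma dfs_tree_exists:
  assumes "graph G" "connected G" "r \<in> verts G"
  shows "\<exists>ts. elimination_tree G (RNode r ts) \<and>
    (\<forall>p. root_leaf_path (RNode r ts) p \<longrightarrow> successively (\<lambda>u v. u \<rightarrow>\<^bsub>G\<^esub> v) p)"
  using assms
proof (induction "card (verts G)" arbitrary: G r rule: less_induct)
  case less
  interpret graph G by fact
  interpret D: graph "del_vert r" using less.prems(1) by (rule graph_del_vert)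
  let ?K = "components (del_vert r)"
  have K: "?K = D.sccs" using D.graph_axioms by (rule components_eq_sccs)
  have "\<forall>C \<in> ?K. \<exists>t. elimination_tree C t \<and>
    (\<forall>p. root_leaf_path t p \<longrightarrow> successively (\<lambda>u v. u \<rightarrow>\<^bsub>G\<^esub> v) (r # p))"
  proof
    fix C assume C: "C \<in> ?K"
    then obtain s where s: "s \<in> verts C" "r \<rightarrow>\<^bsub>G\<^esub> s"
      using component_del_vert_adjacent[OF less.prems] by blast
    have ind: "induced_subgraph C (del_vert r)" and sc: "strongly_connected C"
      using C K by auto
    have gC: "graph C" using D.graph_axioms ind by (rule graph_induced_subgraph)
    have cC: "connected C" using C by (simp add: components_def pre_digraph.max_subgraph_def)
    have sub: "subgraph C G"
      using ind subgraph_del_vert[of r] by (auto intro: subgraph_trans)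
    have "verts C \<subseteq> verts G - {r}"
      using induced_imp_subgraph[OF ind] by (auto simp: subgraph_def del_vert_simps)
    then have "card (verts C) < card (verts G)"
      using less.prems(3) by (intro psubset_card_mono) auto
    from less.hyps[OF this gC cC s(1)] obtain ts where
      ts: "elimination_tree C (RNode s ts)"
        "\<And>p. root_leaf_path (RNode s ts) p \<Longrightarrow> successively (\<lambda>u v. u \<rightarrow>\<^bsub>C\<^esub> v) p"
      by blast
    have "successively (\<lambda>u v. u \<rightarrow>\<^bsub>G\<^esub> v) (r # p)" if p: "root_leaf_path (RNode s ts) p" for p
    proof -
      obtain q where q: "p = s # q" using p by (rule root_leaf_path_hd)
      have "successively (\<lambda>u v. u \<rightarrow>\<^bsub>G\<^esub> v) p"
        using ts(2)[OF p] by (rule successively_mono) (use sub in \<open>auto intro: adj_mono\<close>)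
      then show ?thesis using q s(2) by simp
    qed
    with ts(1) show "\<exists>t. elimination_tree C t \<and>
      (\<forall>p. root_leaf_path t p \<longrightarrow> successively (\<lambda>u v. u \<rightarrow>\<^bsub>G\<^esub> v) (r # p))" by blast
  qed
  then obtain f where f: "\<And>C. C \<in> ?K \<Longrightarrow> elimination_tree C (f C)"
      "\<And>C p. C \<in> ?K \<Longrightarrow> root_leaf_path (f C) p \<Longrightarrow> successively (\<lambda>u v. u \<rightarrow>\<^bsub>G\<^esub> v) (r # p)"
    by metis
  have "finite ?K"
  proof -
    have "D.sccs = induce_subgraph (del_vert r) ` D.sccs_verts"
      by (rule D.sccs_conv_sccs_verts)
    moreover have "D.sccs_verts \<subseteq> Pow (verts (del_vert r))"
      unfolding D.sccs_verts_conv by (auto dest!: D.in_sccs_imp_induced induced_imp_subgraph)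
    ultimately show ?thesis
      using K D.finite_verts by (metis finite_Pow_iff finite_imageI finite_subset)
  qed
  then obtain ts where ts: "fset ts = f ` ?K"
    by (metis finite_imageI Abs_fset_inverse mem_Collect_eq)
  have "elimination_tree G (RNode r ts)"
    using less.prems f(1) ts by (intro elimination_tree.intros) auto
  moreover have "successively (\<lambda>u v. u \<rightarrow>\<^bsub>G\<^esub> v) p" if "root_leaf_path (RNode r ts) p" for p
    using that
  proof cases
    case (2 t q)
    then show ?thesis using f(2) ts by auto
  qed simp
  ultimately show ?case by blast
qed

lemma successively_imp_pair_blocks:
  assumes "successively P p" "even (length p)"
  shows "\<exists>bs. p = concat bs \<and> (\<forall>b \<in> set bs. length b = 2 \<and> successively P b)"
  using assms
proof (induction p rule: induct_list012)
  case 1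
  show ?case by (rule exI[of _ "[]"]) simp
next
  case (2 x)
  then show ?case by simp
next
  case (3 x y zs)
  then have "successively P zs" "P x y" "even (length zs)"
    by (auto simp: successively_Cons)
  with 3 obtain bs where "zs = concat bs" "\<forall>b \<in> set bs. length b = 2 \<and> successively P b"
    by blast
  with \<open>P x y\<close> show ?case by (intro exI[of _ "[x, y] # bs"]) auto
qed

lemma successively_imp_matched_path:
  assumes p: "successively (\<lambda>u v. u \<rightarrow>\<^bsub>G\<^esub> v) p" and len: "length p \<ge> 2"
  shows "matched_path G p"
proof (cases "even (length p)")
  case True
  then show ?thesis using p by (auto simp: matched_path_def successively_conv_nth)
next
  case False
  then obtain x y z q where q: "p = x # y # z # q"
    using len by (cases p; cases "tl p"; cases "tl (tl p)") auto
  then have "successively (\<lambda>u v. u \<rightarrow>\<^bsub>G\<^esub> v) q" "even (length q)"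
    "x \<rightarrow>\<^bsub>G\<^esub> y" "y \<rightarrow>\<^bsub>G\<^esub> z"
    using p False by (auto simp: successively_Cons)
  moreover from this(1,2) obtain bs where bs: "q = concat bs"
    "\<forall>b \<in> set bs. length b = 2 \<and> successively (\<lambda>u v. u \<rightarrow>\<^bsub>G\<^esub> v) b"
    using successively_imp_pair_blocks by blast
  ultimately have "p = concat ([x, y, z] # bs) \<and> 0 < length ([x, y, z] # bs) \<and>
    (\<forall>i < length ([x, y, z] # bs). length (([x, y, z] # bs) ! i) = (if i = 0 then 3 else 2)) \<and>
    (\<forall>b \<in> set ([x, y, z] # bs). successively (\<lambda>u v. u \<rightarrow>\<^bsub>G\<^esub> v) b)"
    using q by (auto simp: nth_Cons split: nat.split)
  then have "\<exists>bs j. p = concat bs \<and> j < length bs \<and>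
      (\<forall>i < length bs. length (bs ! i) = (if i = j then 3 else 2)) \<and>
      (\<forall>b \<in> set bs. successively (\<lambda>u v. u \<rightarrow>\<^bsub>G\<^esub> v) b)"
    by blast
  then show ?thesis using False by (simp add: matched_path_def)
qed

lemma matched_elimination_tree_exists:
  assumes "graph G" "connected G" "card (verts G) \<noteq> 1"
  shows "\<exists>T. matched_elimination_tree G T"
proof -
  interpret graph G by fact
  have ne: "verts G \<noteq> {}" using assms(2) by (simp add: connected_conv)
  then obtain r where r: "r \<in> verts G" by blast
  obtain ts where ts: "elimination_tree G (RNode r ts)"
      "\<And>p. root_leaf_path (RNode r ts) p \<Longrightarrow> successively (\<lambda>u v. u \<rightarrow>\<^bsub>G\<^esub> v) p"
    using dfs_tree_exists[OF assms(1,2) r] by blast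
  interpret D: graph "del_vert r" using assms(1) by (rule graph_del_vert)
  have "verts G \<noteq> {r}" using assms(3) by auto
  then obtain v where "v \<in> verts (del_vert r)" using r by (auto simp: del_vert_simps)
  then have "D.sccs \<noteq> {}" using D.induce_reachable_is_in_sccs by blast
  then have "components (del_vert r) \<noteq> {}" using components_eq_sccs[OF D.graph_axioms] by simp
  then have "ts \<noteq> {||}" using ts(1) by (auto elim: elimination_tree.cases)
  have "matched_path G p" if p: "root_leaf_path (RNode r ts) p" for p
  proof (rule successively_imp_matched_path[OF ts(2)[OF p]])
    show "length p \<ge> 2"
      using p
    proof cases
      case 1
      then show ?thesis using \<open>ts \<noteq> {||}\<close> by simp
    next
      case (2 t q)
      then have "q \<noteq> []" by (auto elim: root_leaf_path.cases)
      then show ?thesis using 2 by (cases q) auto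
    qed
  qed
  with ts(1) show ?thesis by (auto simp: matched_elimination_tree_def)
qed

end

theory Submission
  imports Defs
begin

text \<open>
  Remove the vertices of a tree two levels at a time: a connected graph \<open>H\<close> has pair depth at most
  \<open>k + 1\<close> if it has a vertex \<open>u\<close> such that every component \<open>C\<close> of \<open>H - u\<close> contains a neighbour \<open>v\<close>
  of \<open>u\<close> for which all components of \<open>C - v\<close> have pair depth at most \<open>k\<close>. Pair depth is monotone
  under connected induced subgraphs: if a prescribed vertex is missing, any neighbour can replace
  it. Moreover \<open>mtd H \<le> 2 * k\<close> holds iff \<open>H\<close> has pair depth at most \<open>k\<close>. For one direction, a
  leftover single vertex at the bottom of a path is adjacent to its parent and completes a block of
  size 3. For the other, consider two levels \<open>u\<close>, \<open>v\<close> of a matched tree at which \<open>uv\<close> is not an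
  edge. A block of size 3 then ends at \<open>u\<close> on every path through \<open>v\<close>, so these paths are one
  shorter than the parity of the bound allows, and \<open>v\<close> can be replaced by an arbitrary neighbour
  of \<open>u\<close>.
\<close>

section \<open>Induced subgraphs, vertex deletion and components\<close>

lemma induced_subgraph_del_vert:
  assumes "graph G"
  shows "induced_subgraph (pre_digraph.del_vert G r) G"
proof -
  interpret graph G by fact
  show ?thesis
    using subgraph_del_vert[of r] wellformed
    by (auto simp: induced_subgraph_def del_vert_simps)
qed

lemma induced_subgraph_trans:
  assumes "induced_subgraph H K" "induced_subgraph K G"
  shows "induced_subgraph H G"
  using assms by (auto simp: induced_subgraph_def subgraph_def compatible_def)

lemma induced_subgraph_in_del_vert:
  assumes "graph G" "induced_subgraph H G" "u \<notin> verts H"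
  shows "induced_subgraph H (pre_digraph.del_vert G u)"
proof -
  interpret graph G by fact
  interpret D: graph "del_vert u" using assms(1) by (rule graph_del_vert)
  show ?thesis
    using assms(2,3) D.wf_digraph_axioms wellformed
    by (auto simp: induced_subgraph_def subgraph_def compatible_def del_vert_simps)
qed

lemma dominates_induced_subgraph:
  assumes "induced_subgraph H G" "u \<in> verts H" "v \<in> verts H" "u \<rightarrow>\<^bsub>G\<^esub> v"
  shows "u \<rightarrow>\<^bsub>H\<^esub> v"
  using assms
  by (auto simp: induced_subgraph_def subgraph_def compatible_def arcs_ends_conv)

lemma componentsD:
  assumes "graph G" "C \<in> components G"
  shows "induced_subgraph C G" "connected C" "graph C"
proof -
  interpret graph G by fact
  show "induced_subgraph C G"
    using assms components_eq_sccs by auto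
  then show "graph C" using assms(1) by (rule graph_induced_subgraph[rotated])
  show "connected C"
    using assms by (simp add: components_def pre_digraph.max_subgraph_def)
qed

lemma component_del_vertD:
  assumes "graph G" "C \<in> components (pre_digraph.del_vert G u)"
  shows "induced_subgraph C (pre_digraph.del_vert G u)" "induced_subgraph C G"
    "connected C" "graph C" "u \<notin> verts C"
proof -
  note g = graph_del_vert[OF assms(1)]
  show i: "induced_subgraph C (pre_digraph.del_vert G u)" and "connected C" "graph C"
    using componentsD[OF g assms(2)] by auto
  show "induced_subgraph C G"
    using i induced_subgraph_del_vert[OF assms(1)] by (rule induced_subgraph_trans)
  show "u \<notin> verts C"
    using induced_imp_subgraph[OF i] by (auto simp: subgraph_def pre_digraph.del_vert_simps)
qed

lemma finite_components:
  assumes "graph G"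
  shows "finite (components G)"
proof -
  interpret graph G by fact
  have "sccs_verts \<subseteq> Pow (verts G)"
    unfolding sccs_verts_conv by (auto dest!: in_sccs_imp_induced induced_imp_subgraph)
  then show ?thesis
    using components_eq_sccs[OF assms] sccs_conv_sccs_verts finite_verts
    by (metis finite_Pow_iff finite_imageI finite_subset)
qed

text \<open>Since arcs come in opposite pairs, \<open>H\<close> is strongly connected. It therefore
  lies in the set of vertices reachable from any one of its vertices, and this set induces a
  component.\<close>

lemma connected_induced_subset_component:
  assumes "graph G" "induced_subgraph H G" "connected H"
  shows "\<exists>C \<in> components G. induced_subgraph H C"
proof -
  interpret graph G by fact
  have sub: "subgraph H G" using assms(2) by auto
  have sc: "strongly_connected H" using assms induced_connected_iff by blast
  then obtain x where x: "x \<in> verts H" by (auto simp: strongly_connected_def)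
  let ?S = "{w. x \<rightarrow>\<^sup>*\<^bsub>G\<^esub> w}"
  have "x \<in> verts G" using x sub by auto
  then have "G \<restriction> ?S \<in> sccs" by (rule induce_reachable_is_in_sccs)
  then have C: "G \<restriction> ?S \<in> components G" using components_eq_sccs[OF assms(1)] by simp
  have "verts H \<subseteq> ?S"
    using sc x sub by (auto simp: strongly_connected_def intro: reachable_mono)
  then have "induced_subgraph H (G \<restriction> ?S)"
    using assms(2) componentsD(3)[OF assms(1) C]
    by (auto simp: induced_subgraph_def subgraph_def compatible_def graph_def digraph_def
        fin_digraph_def)
  with C show ?thesis by blast
qed

section \<open>Pair depth and its monotonicity\<close>

text \<open>Level 0 is never attained because every elimination tree has at least its root. A
  one-vertex graph attains level 1, as no component is left after deleting its vertex. No tree is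
  mentioned, so the choice of \<open>v\<close> can be revised freely.\<close>

fun pair_depth_le :: "nat \<Rightarrow> ('a, 'b) pre_digraph \<Rightarrow> bool" where
  "pair_depth_le 0 H = False"
| "pair_depth_le (Suc k) H \<longleftrightarrow>
    (\<exists>u \<in> verts H. \<forall>C \<in> components (pre_digraph.del_vert H u).
      \<exists>v \<in> verts C. u \<rightarrow>\<^bsub>H\<^esub> v \<and>
        (\<forall>D \<in> components (pre_digraph.del_vert C v). pair_depth_le k D))"

text \<open>For situations in which deleting \<open>u\<close> alone already brings the pair depth
  down to \<open>k\<close>. The second vertex then only has to be a neighbour of \<open>u\<close>,
  and connectedness of \<open>H\<close> supplies one in every component.\<close>

lemma pair_depth_le_SucI:
  assumes "graph H" "connected H" "u \<in> verts H"
    and small: "\<And>D. \<lbrakk>connected D; induced_subgraph D (pre_digraph.del_vert H u)\<rbrakk>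
      \<Longrightarrow> pair_depth_le k D"
  shows "pair_depth_le (Suc k) H"
proof -
  have "\<exists>v \<in> verts C. u \<rightarrow>\<^bsub>H\<^esub> v \<and>
      (\<forall>D \<in> components (pre_digraph.del_vert C v). pair_depth_le k D)"
    if C: "C \<in> components (pre_digraph.del_vert H u)" for C
  proof -
    note CD = component_del_vertD[OF assms(1) C]
    obtain v where v: "v \<in> verts C" "u \<rightarrow>\<^bsub>H\<^esub> v"
      using component_del_vert_adjacent[OF assms(1-3) C] by blast
    have "pair_depth_le k D" if "D \<in> components (pre_digraph.del_vert C v)" for D
      using component_del_vertD[OF CD(4) that] CD(1)
      by (intro small) (auto intro: induced_subgraph_trans)
    with v show ?thesis by blast
  qed
  with assms(3) show ?thesis by auto
qed

text \<open>If \<open>u\<close> survives in \<open>H\<close>, each component of \<open>H - u\<close>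
  lies in a component of \<open>G - u\<close> and only \<open>v\<close> may need replacing. If
  \<open>u\<close> is lost, all of \<open>H\<close> lies in one component of \<open>G - u\<close>,
  so a whole level is saved.\<close>

lemma pair_depth_le_induced_subgraph:
  assumes "graph G" "pair_depth_le k G" "induced_subgraph H G" "connected H"
  shows "pair_depth_le k H"
  using assms
proof (induction k arbitrary: G H)
  case 0
  then show ?case by simp
next
  case (Suc k)
  from Suc.prems(2) obtain u where u: "u \<in> verts G"
    and C: "\<And>C. C \<in> components (pre_digraph.del_vert G u) \<Longrightarrow> \<exists>v \<in> verts C. u \<rightarrow>\<^bsub>G\<^esub> v \<and>
        (\<forall>D \<in> components (pre_digraph.del_vert C v). pair_depth_le k D)"
    by auto
  have gH: "graph H" using Suc.prems(1,3) by (rule graph_induced_subgraph)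
  \<comment> \<open>A connected part of \<open>C\<close> that avoids \<open>v\<close> lies in one
    component of \<open>C - v\<close>, where the induction hypothesis applies.\<close>
  have small: "pair_depth_le k D"
    if CD: "graph C" "\<forall>D \<in> components (pre_digraph.del_vert C v). pair_depth_le k D"
      "connected D" "induced_subgraph D C" "v \<notin> verts D"
    for C D :: "('a, 'b) pre_digraph" and v
  proof -
    obtain E where E: "E \<in> components (pre_digraph.del_vert C v)" "induced_subgraph D E"
      using connected_induced_subset_component[OF graph_del_vert[OF CD(1)]
          induced_subgraph_in_del_vert[OF CD(1,4,5)] CD(3)] by blast
    then show ?thesis
      using CD Suc.IH[OF component_del_vertD(4)[OF CD(1) E(1)]] by blast
  qed
  show ?case
  proof (cases "u \<in> verts H")
    case True
    have "\<exists>v \<in> verts C'. u \<rightarrow>\<^bsub>H\<^esub> v \<and>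
        (\<forall>D \<in> components (pre_digraph.del_vert C' v). pair_depth_le k D)"
      if C': "C' \<in> components (pre_digraph.del_vert H u)" for C'
    proof -
      note C'D = component_del_vertD[OF gH C']
      have "induced_subgraph C' G" using C'D(2) Suc.prems(3) by (rule induced_subgraph_trans)
      then obtain C where CC: "C \<in> components (pre_digraph.del_vert G u)" "induced_subgraph C' C"
        using connected_induced_subset_component[OF graph_del_vert[OF Suc.prems(1)]
            induced_subgraph_in_del_vert[OF Suc.prems(1)]] C'D by blast
      note CD = component_del_vertD[OF Suc.prems(1) CC(1)]
      obtain v where v: "v \<in> verts C" "u \<rightarrow>\<^bsub>G\<^esub> v"
        "\<forall>D \<in> components (pre_digraph.del_vert C v). pair_depth_le k D"
        using C[OF CC(1)] by blast
      \<comment> \<open>If \<open>v\<close> is still present it must be deleted, and it stays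
        adjacent to \<open>u\<close> because \<open>H\<close> is induced. Otherwise any neighbour of
        \<open>u\<close> will do. In both cases what remains of \<open>C'\<close> avoids
        \<open>v\<close>, as \<open>small\<close> requires.\<close>
      obtain w where w: "w \<in> verts C'" "u \<rightarrow>\<^bsub>H\<^esub> w" "v \<in> verts C' \<Longrightarrow> w = v"
      proof (cases "v \<in> verts C'")
        case True
        moreover have "v \<in> verts H" using True C'D(2) by auto
        ultimately show ?thesis
          using dominates_induced_subgraph[OF Suc.prems(3) \<open>u \<in> verts H\<close>] v(2) that by blast
      next
        case False
        then show ?thesis
          using component_del_vert_adjacent[OF gH Suc.prems(4) True C'] that by blast
      qed
      have "pair_depth_le k D" if D: "D \<in> components (pre_digraph.del_vert C' w)" for D
      proof (rule small[OF CD(4) v(3)])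
        note DD = component_del_vertD[OF C'D(4) D]
        show "connected D" by (rule DD)
        show "induced_subgraph D C" using DD(2) CC(2) by (rule induced_subgraph_trans)
        show "v \<notin> verts D" using DD(2,5) w(3) by auto
      qed
      with w show ?thesis by blast
    qed
    with True show ?thesis by auto
  next
    case False
    then obtain C where CC: "C \<in> components (pre_digraph.del_vert G u)" "induced_subgraph H C"
      using connected_induced_subset_component[OF graph_del_vert[OF Suc.prems(1)]
          induced_subgraph_in_del_vert[OF Suc.prems(1)]] Suc.prems by blast
    note CD = component_del_vertD[OF Suc.prems(1) CC(1)]
    obtain v where v: "\<forall>D \<in> components (pre_digraph.del_vert C v). pair_depth_le k D"
      using C[OF CC(1)] by blast
    have "verts H \<noteq> {}" using Suc.prems(4) by (auto simp: connected_def strongly_connected_def)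
    \<comment> \<open>Now \<open>w\<close> takes the role of the first vertex of the pair: deleting
      it removes \<open>v\<close> from \<open>H\<close>, after which the bound \<open>k\<close>
      holds everywhere.\<close>
    then obtain w where w: "w \<in> verts H" "v \<in> verts H \<Longrightarrow> w = v" by blast
    show ?thesis
    proof (rule pair_depth_le_SucI[OF gH Suc.prems(4) w(1)])
      fix D assume D: "connected D" "induced_subgraph D (pre_digraph.del_vert H w)"
      have DH: "induced_subgraph D H"
        using D(2) induced_subgraph_del_vert[OF gH] by (rule induced_subgraph_trans)
      have "w \<notin> verts D"
        using induced_imp_subgraph[OF D(2)]
        by (auto simp: subgraph_def pre_digraph.del_vert_simps)
      then have "v \<notin> verts D" using DH w(2) by auto
      with v D(1) induced_subgraph_trans[OF DH CC(2)] show "pair_depth_le k D"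
        using small[OF CD(4)] by blast
    qed
  qed
qed

section \<open>From pair depth to a matched elimination tree\<close>

lemma matched_path_mono:
  assumes "matched_path H p" "\<And>x y. x \<rightarrow>\<^bsub>H\<^esub> y \<Longrightarrow> x \<rightarrow>\<^bsub>G\<^esub> y"
  shows "matched_path G p"
proof (cases "even (length p)")
  case True
  then show ?thesis using assms by (auto simp: matched_path_def)
next
  case False
  then obtain bs j where "p = concat bs" "j < length bs"
    "\<forall>i < length bs. length (bs ! i) = (if i = j then 3 else 2)"
    "\<forall>b \<in> set bs. successively (\<lambda>u v. u \<rightarrow>\<^bsub>H\<^esub> v) b"
    using assms(1) unfolding matched_path_def by meson
  moreover from this(4) have "\<forall>b \<in> set bs. successively (\<lambda>u v. u \<rightarrow>\<^bsub>G\<^esub> v) b"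
    using assms(2) by (blast intro: successively_mono)
  ultimately show ?thesis using False unfolding matched_path_def
    by (simp, intro exI[of _ bs]) auto
qed

text \<open>The pair \<open>u\<close>, \<open>v\<close> becomes a new first block. The parity of the
  length is unchanged, and a block of size 3 moves from index \<open>j\<close> to
  \<open>Suc j\<close>.\<close>

lemma matched_path_Cons_Cons:
  assumes "u \<rightarrow>\<^bsub>G\<^esub> v" "matched_path G p"
  shows "matched_path G (u # v # p)"
proof (cases "even (length p)")
  case True
  have "(u # v # p) ! i \<rightarrow>\<^bsub>G\<^esub> (u # v # p) ! (i + 1)"
    if "even i" "i + 1 < length (u # v # p)" for i
  proof (cases "i = 0")
    case False
    then have "2 \<le> i" using that(1) by (cases "i = 1") auto
    then obtain j where "i = 2 + j" using le_Suc_ex by blast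
    then show ?thesis using assms(2) that True by (auto simp: matched_path_def)
  qed (use assms(1) in simp)
  then show ?thesis using True by (auto simp: matched_path_def)
next
  case False
  then obtain bs j where "p = concat bs" "j < length bs"
    "\<forall>i < length bs. length (bs ! i) = (if i = j then 3 else 2)"
    "\<forall>b \<in> set bs. successively (\<lambda>u v. u \<rightarrow>\<^bsub>G\<^esub> v) b"
    using assms(2) unfolding matched_path_def by meson
  then have "u # v # p = concat ([u, v] # bs) \<and> Suc j < length ([u, v] # bs) \<and>
    (\<forall>i < length ([u, v] # bs). length (([u, v] # bs) ! i) = (if i = Suc j then 3 else 2)) \<and>
    (\<forall>b \<in> set ([u, v] # bs). successively (\<lambda>u v. u \<rightarrow>\<^bsub>G\<^esub> v) b)"
    using assms(1) by (auto simp: nth_Cons split: nat.split)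
  then have "\<exists>bs j. u # v # p = concat bs \<and> j < length bs \<and>
    (\<forall>i < length bs. length (bs ! i) = (if i = j then 3 else 2)) \<and>
    (\<forall>b \<in> set bs. successively (\<lambda>u v. u \<rightarrow>\<^bsub>G\<^esub> v) b)" by blast
  then show ?thesis using False by (simp add: matched_path_def)
qed

lemma matched_path_pair: "u \<rightarrow>\<^bsub>G\<^esub> v \<Longrightarrow> matched_path G [u, v]"
  by (rule successively_imp_matched_path) auto

lemma matched_path_triple: "\<lbrakk>u \<rightarrow>\<^bsub>G\<^esub> v; v \<rightarrow>\<^bsub>G\<^esub> w\<rbrakk> \<Longrightarrow> matched_path G [u, v, w]"
  by (rule successively_imp_matched_path) auto

lemma elimination_tree_cases:
  assumes "elimination_tree G T"
  obtains r ts f where "T = RNode r ts" "connected G" "r \<in> verts G"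
    "\<forall>C \<in> components (pre_digraph.del_vert G r). elimination_tree C (f C)"
    "fset ts = f ` components (pre_digraph.del_vert G r)"
  using assms by cases auto

lemma components_empty_iff:
  assumes "graph G"
  shows "components G = {} \<longleftrightarrow> verts G = {}"
proof -
  interpret graph G by fact
  show ?thesis
  proof
    assume "components G = {}"
    then show "verts G = {}"
      using components_eq_sccs[OF assms] induce_reachable_is_in_sccs by blast
  next
    assume "verts G = {}"
    moreover have "verts C \<subseteq> verts G" "verts C \<noteq> {}" if "C \<in> components G" for C
      using componentsD(1,2)[OF assms that] by (auto simp: connected_def strongly_connected_def)
    ultimately show "components G = {}" by blast
  qed
qed

text \<open>Assembles subtrees below a prescribed root. The property \<open>P\<close> also takes the
  component, so that it can speak about its arcs and vertices. The last conjunct identifies the only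
  graph whose root is a leaf.\<close>

lemma elimination_tree_exists_nodes:
  assumes "graph G" "connected G" "r \<in> verts G"
    and "\<And>C. C \<in> components (pre_digraph.del_vert G r) \<Longrightarrow> \<exists>t. elimination_tree C t \<and> P C t"
  shows "\<exists>ts. elimination_tree G (RNode r ts) \<and>
    (\<forall>t. t |\<in>| ts \<longrightarrow> (\<exists>C \<in> components (pre_digraph.del_vert G r). P C t)) \<and>
    (ts = {||} \<longrightarrow> verts G = {r})"
proof -
  let ?K = "components (pre_digraph.del_vert G r)"
  note g = graph_del_vert[OF assms(1), of r]
  obtain f where f: "\<And>C. C \<in> ?K \<Longrightarrow> elimination_tree C (f C) \<and> P C (f C)"
    using assms(4) by metis
  obtain ts where ts: "fset ts = f ` ?K"
    using finite_components[OF g] by (metis finite_imageI Abs_fset_inverse mem_Collect_eq)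
  have "elimination_tree G (RNode r ts)"
    using assms f ts by (intro elimination_tree.intros) auto
  moreover have "verts G = {r}" if "ts = {||}"
  proof -
    have "?K = {}" using ts that by auto
    then show ?thesis
      using components_empty_iff[OF g] assms(3) by (auto simp: pre_digraph.del_vert_simps)
  qed
  ultimately show ?thesis using f ts by (intro exI[of _ ts]) auto
qed

text \<open>The path \<open>[x]\<close> of a one-vertex graph is not matched, so the induction has
  to carry it as an exception. The next two levels absorb it into a block of size 3.\<close>

lemma pair_depth_le_imp_elimination_tree:
  assumes "graph G" "connected G" "pair_depth_le k G"
  shows "\<exists>T. elimination_tree G T \<and> (\<forall>p. root_leaf_path T p \<longrightarrow>
    length p \<le> 2 * k \<and> (matched_path G p \<or> (\<exists>x. p = [x] \<and> verts G = {x})))"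
  using assms
proof (induction k arbitrary: G)
  case 0
  then show ?case by simp
next
  case (Suc k)
  from Suc.prems(3) obtain u where u: "u \<in> verts G"
    and *: "\<And>C. C \<in> components (pre_digraph.del_vert G u) \<Longrightarrow> \<exists>v \<in> verts C. u \<rightarrow>\<^bsub>G\<^esub> v \<and>
        (\<forall>D \<in> components (pre_digraph.del_vert C v). pair_depth_le k D)"
    by auto
  \<comment> \<open>The paths below \<open>u\<close> are described together with \<open>u\<close>,
    since a path starting at \<open>v\<close> need not be matched on its own.\<close>
  define P where "P = (\<lambda>(C :: ('a, 'b) pre_digraph) t. \<forall>p. root_leaf_path t p \<longrightarrow>
    length (u # p) \<le> 2 * Suc k \<and> matched_path G (u # p))"
  have "\<exists>t. elimination_tree C t \<and> P C t"
    if C: "C \<in> components (pre_digraph.del_vert G u)" for C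
  proof -
    note CD = component_del_vertD[OF Suc.prems(1) C]
    obtain v where v: "v \<in> verts C" "u \<rightarrow>\<^bsub>G\<^esub> v"
        "\<And>D. D \<in> components (pre_digraph.del_vert C v) \<Longrightarrow> pair_depth_le k D"
      using *[OF C] by blast
    define Q where "Q = (\<lambda>(D :: ('a, 'b) pre_digraph) t. \<forall>p. root_leaf_path t p \<longrightarrow>
      length p \<le> 2 * k \<and> (matched_path D p \<or> (\<exists>x. p = [x] \<and> verts D = {x})))"
    have "\<exists>t. elimination_tree D t \<and> Q D t"
      if "D \<in> components (pre_digraph.del_vert C v)" for D
      using Suc.IH[OF _ _ v(3)[OF that]] component_del_vertD[OF CD(4) that]
      unfolding Q_def by blast
    from elimination_tree_exists_nodes[OF CD(4,3) v(1) this]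
    obtain ss where ss: "elimination_tree C (RNode v ss)"
      "\<And>t. t |\<in>| ss \<Longrightarrow> \<exists>D \<in> components (pre_digraph.del_vert C v). Q D t" by blast
    have "length (u # p) \<le> 2 * Suc k \<and> matched_path G (u # p)"
      if "root_leaf_path (RNode v ss) p" for p
      using that
    proof cases
      case 1
      then show ?thesis using v(2) matched_path_pair by auto
    next
      case (2 t q)
      then obtain D where D: "D \<in> components (pre_digraph.del_vert C v)" "Q D t"
        using ss(2) by blast
      note DD = component_del_vertD[OF CD(4) D(1)]
      have adjC: "x \<rightarrow>\<^bsub>G\<^esub> y" if "x \<rightarrow>\<^bsub>C\<^esub> y" for x y
        using that CD(2) by (rule pre_digraph.adj_mono[OF _ induced_imp_subgraph])
      then have adjD: "x \<rightarrow>\<^bsub>G\<^esub> y" if "x \<rightarrow>\<^bsub>D\<^esub> y" for x y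
        using that DD(2) by (blast intro: pre_digraph.adj_mono induced_imp_subgraph)
      have q: "length q \<le> 2 * k" "matched_path D q \<or> (\<exists>x. q = [x] \<and> verts D = {x})"
        using D(2) 2 by (auto simp: Q_def)
      from q(2) have "matched_path G (u # v # q)"
      proof
        assume "matched_path D q"
        then show ?thesis
          using v(2) adjD by (blast intro: matched_path_Cons_Cons matched_path_mono)
      next
        assume "\<exists>x. q = [x] \<and> verts D = {x}"
        then obtain x where x: "q = [x]" "verts D = {x}" by blast
        \<comment> \<open>As \<open>C\<close> is connected, \<open>v\<close> has a neighbour in the
          component \<open>D\<close> of \<open>C - v\<close>, and \<open>x\<close> is the only
          candidate.\<close>
        then have "v \<rightarrow>\<^bsub>C\<^esub> x"
          using component_del_vert_adjacent[OF CD(4,3) v(1) D(1)] by simp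
        then show ?thesis using x(1) v(2) adjC by (auto intro: matched_path_triple)
      qed
      with q(1) 2 show ?thesis by simp
    qed
    with ss(1) show ?thesis unfolding P_def by blast
  qed
  from elimination_tree_exists_nodes[OF Suc.prems(1,2) u this]
  obtain ts where ts: "elimination_tree G (RNode u ts)" "ts = {||} \<longrightarrow> verts G = {u}"
    "\<And>t. t |\<in>| ts \<Longrightarrow> \<exists>C. P C t" by blast
  have "length p \<le> 2 * Suc k \<and> (matched_path G p \<or> (\<exists>x. p = [x] \<and> verts G = {x}))"
    if "root_leaf_path (RNode u ts) p" for p
    using that
  proof cases
    case 1
    then show ?thesis using ts(2) by simp
  next
    case (2 t q)
    then show ?thesis using ts(3)[of t] by (auto simp: P_def)
  qed
  with ts(1) show ?case by blast
qed

section \<open>Matched paths cut off at an even level\<close>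

fun paired :: "('a \<Rightarrow> 'a \<Rightarrow> bool) \<Rightarrow> 'a list \<Rightarrow> bool" where
  "paired E [] = True"
| "paired E [x] = False"
| "paired E (x # y # p) \<longleftrightarrow> E x y \<and> paired E p"

text \<open>
  The bottom parts of matched paths, seen from an even level: the alternative \<open>paired E (y # p)\<close>
  allows \<open>x\<close> to be the last vertex of a block of size 3 whose other vertices were cut off.
\<close>

fun matched_suffix :: "('a \<Rightarrow> 'a \<Rightarrow> bool) \<Rightarrow> 'a list \<Rightarrow> bool" where
  "matched_suffix E [] = True"
| "matched_suffix E [x] = True"
| "matched_suffix E (x # y # p) \<longleftrightarrow> E x y \<and> matched_suffix E p \<or> paired E (y # p)"

lemma paired_imp_even: "paired E p \<Longrightarrow> even (length p)"
  by (induction E p rule: paired.induct) auto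

lemma paired_imp_matched_suffix: "paired E p \<Longrightarrow> matched_suffix E p"
  by (induction E p rule: paired.induct) auto

lemma paired_Cons_imp_matched_suffix: "paired E p \<Longrightarrow> matched_suffix E (x # p)"
  by (cases p) auto

text \<open>This closure permits an induction that descends two levels at a time. If
  \<open>y # p\<close> is paired, removing \<open>y\<close> leaves its partner in front of a paired
  list, which is again a suffix of the second kind.\<close>

lemma matched_suffix_Cons_Cons: "matched_suffix E (x # y # p) \<Longrightarrow> matched_suffix E p"
  by (cases p) (auto dest: paired_Cons_imp_matched_suffix)

lemma pairs_imp_paired:
  assumes "even (length p)" "\<forall>i. even i \<and> i + 1 < length p \<longrightarrow> E (p ! i) (p ! (i + 1))"
  shows "paired E p"
  using assms
proof (induction E p rule: paired.induct)
  case (3 E x y p)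
  have "E (p ! i) (p ! (i + 1))" if "even i" "i + 1 < length p" for i
    using 3(3)[rule_format, of "i + 2"] that by simp
  then show ?case using 3(1,2) 3(3)[rule_format, of 0] by simp
qed auto

lemma pair_blocks_imp_paired:
  assumes "\<forall>b \<in> set bs. length b = 2 \<and> successively E b"
  shows "paired E (concat bs)"
  using assms
  by (induction bs) (auto simp: length_Suc_conv numeral_2_eq_2)

text \<open>Blocks before index \<open>j\<close> are split off as adjacent pairs. From the block
  \<open>[x, y, z]\<close> the edge \<open>xy\<close> is split off, which leaves \<open>z\<close> in
  front of blocks of size 2.\<close>

lemma blocks_imp_matched_suffix:
  assumes "j < length bs" "\<forall>i < length bs. length (bs ! i) = (if i = j then 3 else 2)"
    "\<forall>b \<in> set bs. successively E b"
  shows "matched_suffix E (concat bs)"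
  using assms
proof (induction bs arbitrary: j)
  case Nil
  then show ?case by simp
next
  case (Cons b bs)
  have len: "length (bs ! i) = (if Suc i = j then 3 else 2)" if "i < length bs" for i
    using Cons.prems(2)[rule_format, of "Suc i"] that by simp
  show ?case
  proof (cases j)
    case 0
    then have "length b = 3" using Cons.prems(2)[rule_format, of 0] by simp
    then obtain x y z where b: "b = [x, y, z]" by (auto simp: length_Suc_conv numeral_3_eq_3)
    have "\<forall>b \<in> set bs. length b = 2 \<and> successively E b"
      using len 0 Cons.prems(3) by (auto simp: in_set_conv_nth)
    then have "matched_suffix E (z # concat bs)"
      by (intro paired_Cons_imp_matched_suffix pair_blocks_imp_paired)
    then show ?thesis using b Cons.prems(3) by simp
  next
    case (Suc i)
    then have "length b = 2" using Cons.prems(2)[rule_format, of 0] by simp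
    then obtain x y where b: "b = [x, y]" by (auto simp: length_Suc_conv numeral_2_eq_2)
    have "matched_suffix E (concat bs)"
      using Cons.prems Suc len by (intro Cons.IH[of i]) auto
    then show ?thesis using b Cons.prems(3) by simp
  qed
qed

lemma matched_path_imp_matched_suffix:
  assumes "matched_path G p"
  shows "matched_suffix (\<lambda>u v. u \<rightarrow>\<^bsub>G\<^esub> v) p"
proof (cases "even (length p)")
  case True
  then show ?thesis
    using assms unfolding matched_path_def
    by (intro paired_imp_matched_suffix pairs_imp_paired) auto
next
  case False
  then show ?thesis
    using assms unfolding matched_path_def by (auto intro: blocks_imp_matched_suffix)
qed

text \<open>The implication is required only for vertices on the list. Hence arcs of a graph can be
  replaced by arcs of an induced subgraph containing the list.\<close>

lemma paired_mono_on:
  assumes "paired E p" "\<And>x y. \<lbrakk>x \<in> set p; y \<in> set p; E x y\<rbrakk> \<Longrightarrow> F x y"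
  shows "paired F p"
  using assms by (induction E p rule: paired.induct) auto

lemma matched_suffix_mono_on:
  assumes "matched_suffix E p" "\<And>x y. \<lbrakk>x \<in> set p; y \<in> set p; E x y\<rbrakk> \<Longrightarrow> F x y"
  shows "matched_suffix F p"
  using assms
proof (induction E p rule: matched_suffix.induct)
  case (3 E x y p)
  have "paired F (y # p)" if "paired E (y # p)"
    using that 3(3) by (rule paired_mono_on) auto
  then show ?case using 3 by auto
qed auto

section \<open>From a matched elimination tree to pair depth\<close>

lemma root_leaf_path_in_verts:
  assumes "graph G" "elimination_tree G T" "root_leaf_path T p"
  shows "set p \<subseteq> verts G"
  using assms(2,1,3)
proof (induction arbitrary: p rule: elimination_tree.induct)
  case (1 G r f ts)
  note hyps = "1.hyps" and IH = "1.IH" and G = "1.prems"(1)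
  from "1.prems"(2) show ?case
  proof cases
    case 1
    then show ?thesis using hyps(2) by simp
  next
    case (2 t q)
    then obtain C where C: "C \<in> components (pre_digraph.del_vert G r)" "t = f C"
      using hyps(3) by auto
    then have "set q \<subseteq> verts C"
      using IH 2 component_del_vertD(4)[OF G C(1)] by blast
    then show ?thesis
      using component_del_vertD(2)[OF G C(1)] hyps(2) 2 by auto
  qed
qed

text \<open>The hypothesis uses \<open>matched_suffix\<close> because matchedness of whole paths is
  lost on passing to subtrees: the cut may go through a block of size 3.\<close>

lemma elimination_tree_imp_pair_depth_le:
  assumes "graph G" "elimination_tree G T"
    and "\<And>p. root_leaf_path T p \<Longrightarrow> length p \<le> 2 * k \<and> matched_suffix (\<lambda>u v. u \<rightarrow>\<^bsub>G\<^esub> v) p"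
  shows "pair_depth_le k G"
  using assms
proof (induction k arbitrary: G T)
  case 0
  obtain p where p: "root_leaf_path T p" using root_leaf_path_exists by blast
  then have "p \<noteq> []" by (auto elim: root_leaf_path.cases)
  then show ?case using 0(3)[OF p] by simp
next
  case (Suc k)
  from Suc.prems(2) obtain u ts f where T: "T = RNode u ts" and cG: "connected G"
    and u: "u \<in> verts G"
    and f: "\<And>C. C \<in> components (pre_digraph.del_vert G u) \<Longrightarrow> elimination_tree C (f C)"
    and ts: "fset ts = f ` components (pre_digraph.del_vert G u)"
    by (elim elimination_tree_cases) blast
  have "\<exists>v \<in> verts C. u \<rightarrow>\<^bsub>G\<^esub> v \<and>
      (\<forall>D \<in> components (pre_digraph.del_vert C v). pair_depth_le k D)"
    if C: "C \<in> components (pre_digraph.del_vert G u)" for C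
  proof -
    note CD = component_del_vertD[OF Suc.prems(1) C]
    from f[OF C] obtain v ss g where fC: "f C = RNode v ss" and v: "v \<in> verts C"
      and g: "\<And>D. D \<in> components (pre_digraph.del_vert C v) \<Longrightarrow> elimination_tree D (g D)"
      and ss: "fset ss = g ` components (pre_digraph.del_vert C v)"
      by (elim elimination_tree_cases) blast
    have path: "length (u # p) \<le> 2 * Suc k" "matched_suffix (\<lambda>u v. u \<rightarrow>\<^bsub>G\<^esub> v) (u # p)"
      if "root_leaf_path (f C) p" for p
      using Suc.prems(3)[of "u # p"] root_leaf_path.intros(2)[of "f C" ts p u] that C ts T by auto
    show ?thesis
    proof (cases "u \<rightarrow>\<^bsub>G\<^esub> v")
      case True
      have "pair_depth_le k D" if D: "D \<in> components (pre_digraph.del_vert C v)" for D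
      proof (rule Suc.IH[OF _ g[OF D]])
        note DD = component_del_vertD[OF CD(4) D]
        show "graph D" by (rule DD)
        fix p assume p: "root_leaf_path (g D) p"
        then have vp: "root_leaf_path (f C) (v # p)"
          using fC ss D by (auto intro: root_leaf_path.intros(2))
        have "matched_suffix (\<lambda>u v. u \<rightarrow>\<^bsub>G\<^esub> v) p"
          using path(2)[OF vp] by (rule matched_suffix_Cons_Cons)
        moreover have "set p \<subseteq> verts D" using root_leaf_path_in_verts[OF DD(4) g[OF D] p] .
        moreover have "induced_subgraph D G" using DD(2) CD(2) by (rule induced_subgraph_trans)
        ultimately have "matched_suffix (\<lambda>u v. u \<rightarrow>\<^bsub>D\<^esub> v) p"
          by (elim matched_suffix_mono_on) (auto intro: dominates_induced_subgraph)
        then show "length p \<le> 2 * k \<and> matched_suffix (\<lambda>u v. u \<rightarrow>\<^bsub>D\<^esub> v) p"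
          using path(1)[OF vp] by simp
      qed
      with True v show ?thesis by blast
    next
      case False
      \<comment> \<open>Without the edge \<open>uv\<close>, only the alternative that
        \<open>p\<close> is paired remains. So \<open>p\<close> has even length, its bound
        \<open>2 * k + 1\<close> improves to \<open>2 * k\<close>, and the induction hypothesis
        applies to all of \<open>C\<close> instead of the components of
        \<open>C - v\<close>.\<close>
      have kC: "pair_depth_le k C"
      proof (rule Suc.IH[OF CD(4) f[OF C]])
        fix p assume p: "root_leaf_path (f C) p"
        then obtain q where q: "p = v # q" using fC root_leaf_path_hd by metis
        have pp: "paired (\<lambda>u v. u \<rightarrow>\<^bsub>G\<^esub> v) p" using path(2)[OF p] q False by simp
        have "set p \<subseteq> verts C" using root_leaf_path_in_verts[OF CD(4) f[OF C] p] .
        with pp have "paired (\<lambda>u v. u \<rightarrow>\<^bsub>C\<^esub> v) p"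
          by (elim paired_mono_on) (auto intro: dominates_induced_subgraph[OF CD(2)])
        moreover have "length p \<le> 2 * k"
          using path(1)[OF p] paired_imp_even[OF pp] by (auto elim!: evenE)
        ultimately show "length p \<le> 2 * k \<and> matched_suffix (\<lambda>u v. u \<rightarrow>\<^bsub>C\<^esub> v) p"
          by (blast intro: paired_imp_matched_suffix)
      qed
      obtain w where w: "w \<in> verts C" "u \<rightarrow>\<^bsub>G\<^esub> w"
        using component_del_vert_adjacent[OF Suc.prems(1) cG u C] by blast
      \<comment> \<open>The vertex \<open>w\<close> need not be related to the given tree:
        monotonicity passes the bound for \<open>C\<close> on to every component of
        \<open>C - w\<close>.\<close>
      have "pair_depth_le k D" if "D \<in> components (pre_digraph.del_vert C w)" for D
        using pair_depth_le_induced_subgraph[OF CD(4) kC] component_del_vertD[OF CD(4) that]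
        by blast
      with w show ?thesis by blast
    qed
  qed
  with u show ?case by auto
qed

section \<open>Matched treedepth in terms of pair depth\<close>

lemma length_le_depth: "root_leaf_path T p \<Longrightarrow> length p \<le> depth T"
  unfolding depth_def by (intro Max_ge) (auto simp: finite_root_leaf_paths)

lemma depth_le:
  assumes "\<And>p. root_leaf_path T p \<Longrightarrow> length p \<le> d"
  shows "depth T \<le> d"
  unfolding depth_def using assms root_leaf_path_exists[of T]
  by (subst Max_le_iff) (auto simp: finite_root_leaf_paths)

text \<open>Only even bounds on the matched treedepth are captured, since one unit of pair depth
  accounts for two levels of a tree.\<close>

lemma mtd_connected_le_iff_pair_depth_le:
  assumes "graph G" "connected G"
  shows "mtd_connected G \<le> 2 * k \<longleftrightarrow> pair_depth_le k G"
proof (cases "card (verts G) = 1")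
  case True
  then obtain x where x: "verts G = {x}" by (auto simp: card_1_singleton_iff)
  then have "verts (pre_digraph.del_vert G x) = {}" by (simp add: pre_digraph.del_vert_simps)
  then have "components (pre_digraph.del_vert G x) = {}"
    using components_empty_iff[OF graph_del_vert[OF assms(1)]] by simp
  \<comment> \<open>Both sides amount to \<open>k > 0\<close>: the matched treedepth is 1 by
    convention, and there are no components left to bound.\<close>
  with x True show ?thesis by (cases k) (auto simp: mtd_connected_def)
next
  case False
  let ?P = "\<lambda>d. \<exists>T. matched_elimination_tree G T \<and> depth T = d"
  have mtd: "mtd_connected G = (LEAST d. ?P d)" using False by (simp add: mtd_connected_def)
  show ?thesis
  proof
    assume le: "mtd_connected G \<le> 2 * k"
    have "\<exists>d. ?P d" using matched_elimination_tree_exists[OF assms False] by blast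
    from LeastI_ex[OF this] obtain T where
      T: "matched_elimination_tree G T" "depth T \<le> 2 * k" using le mtd by auto
    then show "pair_depth_le k G"
      using elimination_tree_imp_pair_depth_le[OF assms(1), of T k]
        matched_path_imp_matched_suffix length_le_depth order_trans
      unfolding matched_elimination_tree_def by blast
  next
    assume "pair_depth_le k G"
    from pair_depth_le_imp_elimination_tree[OF assms this] obtain T where
      T: "elimination_tree G T" "\<And>p. root_leaf_path T p \<Longrightarrow>
        length p \<le> 2 * k \<and> (matched_path G p \<or> (\<exists>x. p = [x] \<and> verts G = {x}))" by blast
    \<comment> \<open>The exceptional path \<open>[x]\<close> cannot occur, because \<open>G\<close>
      does not have exactly one vertex.\<close>
    then have "matched_elimination_tree G T"
      using False by (fastforce simp: matched_elimination_tree_def)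
    then have "mtd_connected G \<le> depth T" unfolding mtd by (intro Least_le) blast
    also have "\<dots> \<le> 2 * k" using T(2) by (blast intro: depth_le)
    finally show "mtd_connected G \<le> 2 * k" .
  qed
qed

theorem theorem4:
  fixes G G' :: "('a, 'b) pre_digraph"
  assumes "graph G"
    and "induced_subgraph G' G"
    and "connected G'"
  shows "(even (mtd G) \<longrightarrow> mtd G' \<le> mtd G) \<and>
         (odd (mtd G) \<longrightarrow> mtd G' \<le> mtd G + 1)"
proof -
  have g': "graph G'" using assms(1,2) by (rule graph_induced_subgraph)
  obtain C where C: "C \<in> components G" "induced_subgraph G' C"
    using connected_induced_subset_component[OF assms] by blast
  note CD = componentsD[OF assms(1) C(1)]
  have "mtd G' \<le> 2 * k" if "mtd G \<le> 2 * k" for k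
  proof -
    have "mtd_connected C \<le> mtd G"
      unfolding mtd_def using finite_components[OF assms(1)] C(1) by (intro Max_ge) auto
    then have "pair_depth_le k C"
      using that mtd_connected_le_iff_pair_depth_le[OF CD(3,2), of k] by simp
    then have "pair_depth_le k G'"
      using pair_depth_le_induced_subgraph[OF CD(3) _ C(2) assms(3)] by blast
    then show ?thesis
      using mtd_connected_le_iff_pair_depth_le[OF g' assms(3), of k]
        mtd_eq_mtd_connected[OF g' assms(3)] by simp
  qed
  \<comment> \<open>Twice this value is the least even number that is at least \<open>mtd G\<close>,
    namely \<open>mtd G\<close> in the even case and \<open>mtd G + 1\<close> in the odd
    case.\<close>
  from this[of "(mtd G + 1) div 2"] show ?thesis by (auto elim!: evenE oddE)
qed

end
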